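(* Let $\Omega\subset\mathbb{C}$ be a Jordan region and let $\Psi$ be a peripheral conformal mapping of $\partial\Omega$ with reference radius $1$. For $N\ge3$ put $\omega=\mathrm{e}^{2\pi\mathrm{i}/N}$, $z_k=\Psi(\omega^k)$ for $k\in\mathbb{Z}$ (so $z_0=z_N$, $z_{N+1}=z_1$), and for $k=1,\dots,N$ $$\zeta_k^{\mathrm{C}}(R)=\Psi(R\omega^k)\quad(R>1\text{ close to }1),\qquad \zeta_k^{\mathrm{A}}(r)=z_k-\frac{\mathrm{i}r}{2}(z_{k+1}-z_{k-1})\quad(r>0).$$ Then $$\zeta_k^{\mathrm{C}}(R)=\zeta_k^{\mathrm{A}}\left(\frac{R-1}{\sin(2\pi/N)}\right)+O((R-1)^2)+O((R-1)N^{-1})\quad\text{as }R\downarrow1,\ N\to\infty,$$ uniformly in $k$; that is, there exist $C>0$, $R_0>1$ and $N_0\ge3$ such that for all $R\in(1,R_0)$, all integers $N\ge N_0$ and all $k\in\{1,\dots,N\}$, $$\left|\zeta_k^{\mathrm{C}}(R)-\zeta_k^{\mathrm{A}}\left(\frac{R-1}{\sin(2\pi/N)}\right)\right|\le C\left((R-1)^2+(R-1)N^{-1}\right).$$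
   Context: **Peripheral conformal mapping.** For a Jordan curve $\Gamma$ in the plane and $\rho>0$, let $\gamma_\rho=\{z\in\mathbb{C}\mid|z|=\rho\}$. A mapping $\Psi$ from a neighborhood of $\gamma_\rho$ to $\mathbb{C}$ is called a peripheral conformal mapping of $\Gamma$ with reference radius $\rho$ if (1) $\Psi$ maps $\gamma_\rho$ onto $\Gamma$, and (2) for some $\kappa>1$, $\Psi$ is a conformal mapping (holomorphic and injective) on the closed annulus $\{z\in\mathbb{C}\mid\kappa^{-1}\rho\le|z|\le\kappa\rho\}$. The points $z_k$ are the collocation points on $\partial\Omega$; $\zeta_k^{\mathrm{C}}(R)$ are the singular points arranged by the peripheral conformal mapping; $\zeta_k^{\mathrm{A}}(r)$ are the singular points given by Amano's arrangement with parameter $r$. *)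

theory Defs
  imports "HOL-Complex_Analysis.Complex_Analysis"
begin

definition jordan_curve :: "complex set \<Rightarrow> bool" where
  "jordan_curve \<Gamma> \<longleftrightarrow>
     (\<exists>g. simple_path g \<and> pathfinish g = pathstart g \<and> path_image g = \<Gamma>)"

definition jordan_region :: "complex set \<Rightarrow> bool" where
  "jordan_region \<Omega> \<longleftrightarrow> (\<exists>\<Gamma>. jordan_curve \<Gamma> \<and> \<Omega> = inside \<Gamma>)"

definition closed_annulus :: "real \<Rightarrow> real \<Rightarrow> complex set" where
  "closed_annulus a b = {z. a \<le> norm z \<and> norm z \<le> b}"

(* The mapping is a total function; only its values on a neighbourhood of the circle
   of radius rho matter. Being holomorphic on a closed set means being holomorphic on
   some open set containing it, which is analytic_on. *)
definition peripheral_conformal_mapping ::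
    "complex set \<Rightarrow> real \<Rightarrow> (complex \<Rightarrow> complex) \<Rightarrow> bool" where
  "peripheral_conformal_mapping \<Gamma> \<rho> \<Psi> \<longleftrightarrow>
     jordan_curve \<Gamma> \<and> \<rho> > 0 \<and>
     \<Psi> ` sphere 0 \<rho> = \<Gamma> \<and>
     (\<exists>\<kappa>>1. \<Psi> analytic_on closed_annulus (inverse \<kappa> * \<rho>) (\<kappa> * \<rho>) \<and>
            inj_on \<Psi> (closed_annulus (inverse \<kappa> * \<rho>) (\<kappa> * \<rho>)))"

definition omega :: "nat \<Rightarrow> complex" where
  "omega N = exp (2 * of_real pi * \<i> / of_nat N)"

definition collocation_point :: "(complex \<Rightarrow> complex) \<Rightarrow> nat \<Rightarrow> int \<Rightarrow> complex" where
  "collocation_point \<Psi> N k = \<Psi> (omega N powi k)"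

definition zeta_C :: "(complex \<Rightarrow> complex) \<Rightarrow> nat \<Rightarrow> real \<Rightarrow> int \<Rightarrow> complex" where
  "zeta_C \<Psi> N R k = \<Psi> (of_real R * omega N powi k)"

(* Amano's arrangement depends only on the sequence z of collocation points. *)
definition zeta_A :: "(int \<Rightarrow> complex) \<Rightarrow> real \<Rightarrow> int \<Rightarrow> complex" where
  "zeta_A z r k = z k - \<i> * of_real r / 2 * (z (k + 1) - z (k - 1))"

end

theory Submission imports Defs begin

text \<open>
  Both sides agree with \<open>\<Psi>(a) + (R - 1) a \<Psi>'(a)\<close>, where \<open>a = \<omega>\<^sup>k\<close>, up to the
  claimed error: the first-order Taylor expansion of \<open>\<Psi>\<close> at \<open>a\<close>, whose remainder is uniformly
  quadratic on the annulus, is applied at \<open>R a\<close> and at \<open>a \<omega>\<^sup>\<plusminus>\<^sup>1\<close>, and the factor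
  \<open>sin (2\<pi>/N)\<close> is exactly what normalises \<open>a \<omega> - a / \<omega> = 2 \<i> a sin (2\<pi>/N)\<close>.
\<close>

text \<open>The second derivative is bounded on the compact set \<open>K\<close>. Taylor's theorem
  needs a convex domain, which an annulus is not, so it is applied on convex subsets
  \<open>S\<close> with a \<open>B\<close> that depends only on \<open>f\<close> and
  \<open>K\<close>.\<close>

lemma analytic_on_compact_Taylor1:
  fixes f :: "complex \<Rightarrow> complex"
  assumes "f analytic_on K" "compact K"
  obtains B where "B > 0"
    "\<And>S w z. convex S \<Longrightarrow> S \<subseteq> K \<Longrightarrow> w \<in> S \<Longrightarrow> z \<in> S \<Longrightarrow>
       norm (f z - f w - deriv f w * (z - w)) \<le> B * norm (z - w) ^ 2"
proof -
  have d1: "deriv f analytic_on K" and d2: "deriv (deriv f) analytic_on K"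
    using assms(1) by (auto intro!: analytic_deriv)
  have "bounded (deriv (deriv f) ` K)"
    using d2 assms(2)
    by (intro compact_imp_bounded compact_continuous_image holomorphic_on_imp_continuous_on
        analytic_imp_holomorphic)
  then obtain B where B: "B > 0" "\<And>x. x \<in> K \<Longrightarrow> norm (deriv (deriv f) x) \<le> B"
    by (auto simp: bounded_pos)
  show thesis
  proof (rule that[OF B(1)])
    fix S w z assume S: "convex S" "S \<subseteq> K" "w \<in> S" "z \<in> S"
    have "norm ((deriv ^^ 0) f z - (\<Sum>i\<le>1. (deriv ^^ i) f w * (z - w) ^ i / fact i))
            \<le> B * norm (z - w) ^ Suc 1 / fact 1"
    proof (rule complex_Taylor[OF S(1) _ _ S(3,4)])
      fix i x assume x: "x \<in> S" and i: "i \<le> (1::nat)"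
      have "(deriv ^^ i) f analytic_on {x}"
        using i x S(2) assms(1) d1 by (cases i) (auto intro: analytic_on_subset)
      then show "((deriv ^^ i) f has_field_derivative (deriv ^^ Suc i) f x) (at x within S)"
        by (auto intro!: has_field_derivative_at_within DERIV_deriv_iff_field_differentiable[THEN iffD2]
            intro: analytic_on_imp_differentiable_at)
    qed (use B(2) S(2) in auto)
    then show "norm (f z - f w - deriv f w * (z - w)) \<le> B * norm (z - w) ^ 2"
      by (simp add: power2_eq_square algebra_simps)
  qed
qed

text \<open>The radius is the gap to the inner circle; the gap \<open>\<kappa> - 1\<close> to the
  outer circle is at least as large because \<open>(\<kappa> - 1)\<^sup>2 / \<kappa>\<close> is
  nonnegative. These discs are the convex sets used for the Taylor bound.\<close>

lemma cball_subset_closed_annulus: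
  assumes "norm a = 1" "\<kappa> > 1"
  shows "cball a (1 - inverse \<kappa>) \<subseteq> closed_annulus (inverse \<kappa>) \<kappa>"
proof
  fix z assume "z \<in> cball a (1 - inverse \<kappa>)"
  then have d: "norm (z - a) \<le> 1 - inverse \<kappa>"
    by (simp add: dist_norm norm_minus_commute)
  have "(\<kappa> - 1)\<^sup>2 / \<kappa> \<ge> 0"
    using assms by simp
  then have "2 - inverse \<kappa> \<le> \<kappa>"
    using assms by (simp add: field_simps power2_eq_square)
  moreover have "norm z \<le> norm a + norm (z - a)" "norm a \<le> norm z + norm (z - a)"
    using norm_triangle_ineq[of a "z - a"] norm_triangle_ineq4[of z "z - a"] by simp_all
  ultimately show "z \<in> closed_annulus (inverse \<kappa>) \<kappa>"
    using d assms by (simp add: closed_annulus_def)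
qed

lemma compact_closed_annulus: "compact (closed_annulus a b)"
proof -
  have "closed_annulus a b = cball 0 b - ball 0 a"
    by (auto simp: closed_annulus_def)
  then show ?thesis
    by (simp add: compact_diff)
qed

lemma omega_eq_cis: "omega N = cis (2 * pi / real N)"
  by (simp add: omega_def cis_conv_exp mult_ac)

lemma norm_omega_powi: "norm (omega N powi k) = 1"
  by (simp add: norm_power_int omega_eq_cis)

lemma norm_mult_cis_diff:
  assumes "norm a = 1"
  shows "norm (a * cis t - a) = 2 * \<bar>sin (t / 2)\<bar>"
proof -
  have "norm (a * cis t - a) = norm (a * (cis t - 1))"
    by (simp add: algebra_simps)
  also have "\<dots> = 2 * \<bar>sin (t / 2)\<bar>"
    using dist_exp_i_1[of t] assms by (simp add: norm_mult cis_conv_exp)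
  finally show ?thesis .
qed

text \<open>The linear parts of the two expansions give \<open>a * D * 2 * \<i> * sin t\<close>,
  which the prefactor turns into \<open>- a * D\<close>. What survives is two remainders of order
  \<open>t\<^sup>2\<close> divided by \<open>sin t\<close>, hence of order \<open>t\<close>.\<close>

lemma central_difference_bound:
  fixes f :: "complex \<Rightarrow> complex"
  assumes t: "0 < t" "t \<le> 2 * pi / 3" and a: "norm a = 1" and B: "B \<ge> 0"
    and taylor: "\<And>u. u \<in> {t, -t} \<Longrightarrow>
      norm (f (a * cis u) - f a - D * (a * cis u - a)) \<le> B * norm (a * cis u - a) ^ 2"
  shows "norm (\<i> / (2 * of_real (sin t)) * (f (a * cis t) - f (a * cis (- t))) + a * D)
           \<le> 2 * B * t"
proof -
  \<comment> \<open>The common chord length from \<open>a\<close> to its two neighbours.\<close>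
  define s where "s = 2 * sin (t / 2)"
  \<comment> \<open>The bound \<open>2 * pi / 3\<close> on \<open>t\<close> enters here: it keeps
    \<open>sin t\<close> at least half the chord \<open>s\<close>.\<close>
  have c: "1 / 2 \<le> cos (t / 2)"
    using cos_monotone_0_pi_le[of "t / 2" "pi / 3"] t cos_60 by simp
  have s: "0 < s" "s \<le> t"
    using t sin_gt_zero[of "t / 2"] sin_x_le_x[of "t / 2"] by (auto simp: s_def)
  have sin: "sin t = s * cos (t / 2)"
    using sin_double[of "t / 2"] by (simp add: s_def)
  then have sin_pos: "sin t > 0"
    using s c by simp
  have dist: "norm (a * cis u - a) = s" if "u \<in> {t, -t}" for u
    using that s by (auto simp: norm_mult_cis_diff[OF a] s_def)
  define E where "E u = f (a * cis u) - f a - D * (a * cis u - a)" for u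
  have E: "norm (E u) \<le> B * s\<^sup>2" if "u \<in> {t, -t}" for u
    using taylor[OF that] dist[OF that] by (simp add: E_def)
  have "cis t - cis (- t) = 2 * \<i> * of_real (sin t)"
    by (simp add: complex_eq_iff)
  moreover have "f (a * cis t) - f (a * cis (- t))
      = a * D * (cis t - cis (- t)) + (E t - E (- t))"
    by (simp add: E_def algebra_simps)
  ultimately have "f (a * cis t) - f (a * cis (- t))
      = a * D * (2 * \<i> * of_real (sin t)) + (E t - E (- t))"
    by simp
  then have "\<i> / (2 * of_real (sin t)) * (f (a * cis t) - f (a * cis (- t))) + a * D
      = \<i> / (2 * of_real (sin t)) * (E t - E (- t))"
    by (simp only:) (use sin_pos in \<open>simp add: field_simps\<close>)
  also have "norm \<dots> = norm (E t - E (- t)) / (2 * sin t)"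
    using sin_pos by (simp add: norm_mult norm_divide)
  also have "\<dots> \<le> (B * s\<^sup>2 + B * s\<^sup>2) / (2 * sin t)"
    using E sin_pos by (intro divide_right_mono order.trans[OF norm_triangle_ineq4] add_mono) auto
  also have "\<dots> = B * s / cos (t / 2)"
    using s c by (simp add: sin power2_eq_square field_simps)
  also have "\<dots> \<le> B * s / (1 / 2)"
    using s c B by (intro divide_left_mono) auto
  also have "\<dots> \<le> 2 * B * t"
    using s B by (simp add: mult_left_mono)
  finally show ?thesis .
qed

theorem theorem4p1:
  fixes \<Omega> :: "complex set" and \<Psi> :: "complex \<Rightarrow> complex"
  assumes "jordan_region \<Omega>"
    and "peripheral_conformal_mapping (frontier \<Omega>) 1 \<Psi>"
  shows "\<exists>C>0. \<exists>R0>1. \<exists>N0\<ge>3. \<forall>R\<in>{1<..<R0::real}. \<forall>N\<ge>N0::nat. \<forall>k\<in>{1..int N}.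
           norm (zeta_C \<Psi> N R k
                 - zeta_A (collocation_point \<Psi> N) ((R - 1) / sin (2 * pi / real N)) k)
             \<le> C * ((R - 1)^2 + (R - 1) * inverse (real N))"
proof -
  obtain \<kappa> where \<kappa>: "\<kappa> > 1" and an: "\<Psi> analytic_on closed_annulus (inverse \<kappa>) \<kappa>"
    using assms(2) by (auto simp: peripheral_conformal_mapping_def)
  obtain B where B: "B > 0" and taylor: "\<And>S w z. convex S \<Longrightarrow> S \<subseteq> closed_annulus (inverse \<kappa>) \<kappa>
      \<Longrightarrow> w \<in> S \<Longrightarrow> z \<in> S \<Longrightarrow>
       norm (\<Psi> z - \<Psi> w - deriv \<Psi> w * (z - w)) \<le> B * norm (z - w) ^ 2"
    using analytic_on_compact_Taylor1[OF an compact_closed_annulus] by blast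
  define \<delta> where "\<delta> = 1 - inverse \<kappa>"
  have \<delta>: "\<delta> > 0"
    using \<kappa> by (simp add: \<delta>_def field_simps)
  have taylor_\<delta>: "norm (\<Psi> z - \<Psi> a - deriv \<Psi> a * (z - a)) \<le> B * norm (z - a) ^ 2"
    if "norm a = 1" "norm (z - a) \<le> \<delta>" for a z
    using taylor[of "cball a \<delta>" a z] cball_subset_closed_annulus[OF that(1) \<kappa>] that(2) \<delta>
    by (simp add: \<delta>_def dist_norm norm_minus_commute)
  \<comment> \<open>With \<open>t = 2 * pi / N\<close>, the entry 3 gives
    \<open>t \<le> 2 * pi / 3\<close> and the other entry gives \<open>t \<le> \<delta>\<close>, so
    both neighbours of \<open>a\<close> lie in the Taylor disc.\<close>
  define N0 where "N0 = max 3 (nat \<lceil>2 * pi / \<delta>\<rceil>)"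
  have main: "norm (zeta_C \<Psi> N R k
                 - zeta_A (collocation_point \<Psi> N) ((R - 1) / sin (2 * pi / real N)) k)
             \<le> (4 * pi * B) * ((R - 1)^2 + (R - 1) * inverse (real N))"
    if R: "R \<in> {1<..<1 + \<delta>}" and N: "N \<ge> N0" for R N and k :: int
  proof -
    define t where "t = 2 * pi / real N"
    define a where "a = omega N powi k"
    define D where "D = deriv \<Psi> a"
    have N3: "N \<ge> 3" and N\<delta>: "2 * pi / \<delta> \<le> real N"
      using N by (auto simp: N0_def)
    have t: "0 < t" "t \<le> 2 * pi / 3" "t \<le> \<delta>"
      using N3 N\<delta> \<delta> by (auto simp: t_def field_simps)
    have a: "norm a = 1"
      by (simp add: a_def norm_omega_powi)
    have om: "omega N = cis t" "omega N \<noteq> 0"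
      by (simp_all add: t_def omega_eq_cis)
    have next_pt: "omega N powi (k + 1) = a * cis t" "omega N powi (k - 1) = a * cis (- t)"
      by (simp_all add: a_def om power_int_add power_int_diff divide_inverse)
    \<comment> \<open>\<open>(R - 1) * Q\<close> is the first-order displacement
      \<open>(R - 1) * a * D\<close> of \<open>\<Psi>\<close> from \<open>a\<close> to
      \<open>R * a\<close>, minus Amano's displacement.\<close>
    define Q where "Q = \<i> / (2 * of_real (sin t)) * (\<Psi> (a * cis t) - \<Psi> (a * cis (- t))) + a * D"
    have "norm Q \<le> 2 * B * t"
      unfolding Q_def
    proof (rule central_difference_bound[OF t(1,2) a])
      fix u assume u: "u \<in> {t, - t}"
      \<comment> \<open>A chord is no longer than its arc.\<close>
      then have "norm (a * cis u - a) \<le> t"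
        using abs_sin_x_le_abs_x[of "u / 2"] t by (auto simp: norm_mult_cis_diff[OF a])
      then show "norm (\<Psi> (a * cis u) - \<Psi> a - D * (a * cis u - a)) \<le> B * norm (a * cis u - a) ^ 2"
        unfolding D_def using t by (intro taylor_\<delta> a) simp
    qed (use B in simp)
    moreover have "norm (\<Psi> (R * a) - \<Psi> a - D * (R * a - a)) \<le> B * (R - 1)\<^sup>2"
    proof -
      have "R * a - a = of_real (R - 1) * a"
        by (simp add: algebra_simps)
      then have "norm (R * a - a) = R - 1"
        using R a by (simp only: norm_mult norm_of_real) simp
      then show ?thesis
        using taylor_\<delta>[OF a, of "R * a"] R by (simp add: D_def)
    qed
    moreover have "zeta_C \<Psi> N R k - zeta_A (collocation_point \<Psi> N) ((R - 1) / sin t) k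
        = (\<Psi> (R * a) - \<Psi> a - D * (R * a - a)) + of_real (R - 1) * Q"
      unfolding zeta_C_def zeta_A_def collocation_point_def next_pt Q_def
      by (simp add: a_def[symmetric] algebra_simps diff_divide_distrib)
    moreover have "norm (of_real (R - 1) * Q) = (R - 1) * norm Q"
      using R by (simp only: norm_mult norm_of_real) simp
    ultimately have "norm (zeta_C \<Psi> N R k
          - zeta_A (collocation_point \<Psi> N) ((R - 1) / sin t) k)
        \<le> B * (R - 1)\<^sup>2 + (R - 1) * (2 * B * t)"
      using R by (simp only:) (intro order.trans[OF norm_triangle_ineq] add_mono mult_left_mono; simp)
    \<comment> \<open>The second term equals \<open>4 * pi * B * (R - 1) / N\<close>, so the first
      coefficient is enlarged to match it.\<close>
    also have "\<dots> \<le> (4 * pi * B) * (R - 1)\<^sup>2 + (R - 1) * (2 * B * t)"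
      using B pi_gt3 by (intro add_right_mono mult_right_mono) auto
    also have "\<dots> = (4 * pi * B) * ((R - 1)^2 + (R - 1) * inverse (real N))"
      by (simp add: t_def field_simps)
    finally show ?thesis
      by (simp add: t_def)
  qed
  show ?thesis
  proof (intro exI conjI ballI allI impI)
    show "4 * pi * B > 0" "1 + \<delta> > 1" "N0 \<ge> 3"
      using B \<delta> by (auto simp: N0_def)
  qed (rule main)
qed

end
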